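(* Let $k\ge 3$ and $n\ge 1$ be integers, and let $\mathcal{S}(n,k)$ be the Sierpiński graph, with $N_n=k^n$ vertices. The second-order network coherence of $\mathcal{S}(n,k)$ is $$\begin{aligned}H_2(\mathcal{S}(n,k))=&-\frac{7k^2+13k+2}{2k^{n+1}(k+1)^2(k+2)^2(k+3)}-\frac{(k-2)(k^3+4k^2+4k+2)}{2k^2(k+2)^2(k^2+3k+4)}\\&+\frac{(k-1)(k+2)^{n-2}(k^2+k+2)}{2k^{n+1}(k+1)^2}\\&+\frac{k^5+7k^4+16k^3+28k^2+26k+12}{2k^{n+2}(k+1)^2(k+3)(k^2+3k+4)}\,(k-1)(k+2)^{2n-2}.\end{aligned}$$ Moreover, for fixed $k$, as $n\to\infty$, $$H_2(\mathcal{S}(n,k))\sim h(k)\,N_n^{\frac{2\log (k+2)}{\log k}-1},$$ i.e. the ratio of the two sides tends to $1$, where $$h(k)=\frac{(k^5+7k^4+16k^3+28k^2+26k+12)(k-1)}{2k^2(k+1)^2(k+2)^2(k+3)(k^2+3k+4)}.$$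
   Context: Sierpiński graphs: for $n\ge 1$ and $k\ge 3$, $\mathcal{S}(n,k)$ has vertex set $\{1,2,\dots,k\}^n$, and two vertices $p=p_1p_2\cdots p_n$ and $q=q_1q_2\cdots q_n$ are adjacent if and only if there is an integer $h$, $1\le h\le n$, such that (a) $p_i=q_i$ for $1\le i\le h-1$; (b) $p_h\ne q_h$; (c) $p_i=q_h$ and $q_i=p_h$ for $h+1\le i\le n$. Second-order network coherence: let $\mathcal{G}$ be a connected undirected graph with $N$ vertices and Laplacian matrix $\mathbf{L}=\mathbf{D}-\mathbf{A}$ (degree matrix minus adjacency matrix), with eigenvalues $0=\lambda_1<\lambda_2\le\cdots\le\lambda_N$. Consider the dynamics $\dot x(t)=v(t)$, $\dot v(t)=-\mathbf{L}x(t)-\mathbf{L}v(t)+w(t)$ with positions $x(t)\in\mathbb{R}^N$, velocities $v(t)\in\mathbb{R}^N$, and $w(t)\in\mathbb{R}^N$ a mutually uncorrelated (unit-intensity) white noise process. The second-order network coherence $H_2(\mathcal{G})$ is the mean (over vertices) steady-state variance of the deviation of each vertex's position from the average of all positions. It is a known fact, which may be taken as the definition of $H_2$, that $H_2(\mathcal{G})=\frac{1}{2N}\sum_{i=2}^{N}\frac{1}{\lambda_i^2}$. *)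

theory Defs
  imports Complex_Main
    "Graph_Theory.Pair_Digraph"
    "Jordan_Normal_Form.Char_Poly"
begin

text \<open>
  An undirected graph is represented by a symmetric arc relation (\<open>pair_graph\<close>), so every edge
  occurs as two arcs and the degree of a vertex is its out-degree.
\<close>

text \<open>
  Words are lists, whose entries are numbered from 0: the position \<open>h\<close> ranging over \<open>1, \<dots>, n\<close>
  becomes an index \<open>h < n\<close>.
\<close>

definition sierpinski :: "nat \<Rightarrow> nat \<Rightarrow> nat list pair_pre_digraph" where
  "sierpinski n k =
    (let V = {p. length p = n \<and> set p \<subseteq> {1..k}} in
     \<lparr> pverts = V,
       parcs = {(p, q). p \<in> V \<and> q \<in> V \<and>
         (\<exists>h<n. (\<forall>i<h. p ! i = q ! i) \<and> p ! h \<noteq> q ! h \<and>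
                (\<forall>i. h < i \<and> i < n \<longrightarrow> p ! i = q ! h \<and> q ! i = p ! h))} \<rparr>)"

lemma pair_graph_sierpinski: "pair_graph (sierpinski n k)"
proof
  let ?V = "{p::nat list. length p = n \<and> set p \<subseteq> {1..k}}"
  have verts: "pverts (sierpinski n k) = ?V"
    and arcs: "parcs (sierpinski n k) \<subseteq> ?V \<times> ?V"
    by (auto simp: sierpinski_def Let_def)
  have fin: "finite ?V"
    using finite_lists_length_eq[of "{1..k}" n] by (simp add: conj_commute)
  show "finite (pverts (sierpinski n k))"
    using fin verts by simp
  show "finite (parcs (sierpinski n k))"
    using arcs fin by (rule finite_subset[OF _ finite_cartesian_product]) (rule fin)
  show "fst e \<in> pverts (sierpinski n k)" "snd e \<in> pverts (sierpinski n k)"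
    if "e \<in> parcs (sierpinski n k)" for e
    using subsetD[OF arcs that] unfolding verts by (auto simp: mem_Times_iff simp del: atLeastAtMost_iff)
  show "fst e \<noteq> snd e" if "e \<in> parcs (sierpinski n k)" for e
  proof -
    obtain p q where "e = (p, q)" by (cases e)
    with that obtain h where "p ! h \<noteq> q ! h" unfolding sierpinski_def Let_def by auto
    with \<open>e = (p, q)\<close> show ?thesis by auto
  qed
  show "symmetric (with_proj (sierpinski n k))"
    unfolding symmetric_def with_proj_simps
  proof (rule symI)
    fix p q
    assume "(p, q) \<in> parcs (sierpinski n k)"
    then obtain h where "p \<in> ?V" "q \<in> ?V" "h < n" "\<forall>i<h. p ! i = q ! i" "p ! h \<noteq> q ! h"
      "\<forall>i. h < i \<and> i < n \<longrightarrow> p ! i = q ! h \<and> q ! i = p ! h"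
      unfolding sierpinski_def Let_def pair_pre_digraph.select_convs by blast
    then show "(q, p) \<in> parcs (sierpinski n k)"
      unfolding sierpinski_def Let_def pair_pre_digraph.select_convs mem_Collect_eq prod.case
      by (intro conjI exI[of _ h]) (assumption | simp)+
  qed
qed

text \<open>
  Matrices of a finite graph are indexed by positions in an arbitrary enumeration of the vertices;
  another enumeration conjugates them by a permutation matrix and so does not affect the spectrum.
\<close>

definition vertex_list :: "'a pair_pre_digraph \<Rightarrow> 'a list" where
  "vertex_list G = (SOME vs. distinct vs \<and> set vs = pverts G)"

definition degree_matrix :: "'a pair_pre_digraph \<Rightarrow> real mat" where
  "degree_matrix G = (let vs = vertex_list G; N = length vs in
     mat N N (\<lambda>(i, j). if i = j then real (out_degree (with_proj G) (vs ! i)) else 0))"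

definition adjacency_matrix :: "'a pair_pre_digraph \<Rightarrow> real mat" where
  "adjacency_matrix G = (let vs = vertex_list G; N = length vs in
     mat N N (\<lambda>(i, j). if (vs ! i, vs ! j) \<in> parcs G then 1 else 0))"

definition laplacian :: "'a pair_pre_digraph \<Rightarrow> real mat" where
  "laplacian G = degree_matrix G - adjacency_matrix G"

text \<open>
  The eigenvalues with multiplicity. The Laplacian of an undirected graph is real symmetric,
  so all roots of its characteristic polynomial are real and this multiset has \<open>N\<close> elements.
\<close>

definition laplacian_spectrum :: "'a pair_pre_digraph \<Rightarrow> real multiset" where
  "laplacian_spectrum G = proots (char_poly (laplacian G))"

text \<open>
  Second-order coherence of a connected graph: one copy of the eigenvalue 0 (that is,
  \<open>\<lambda>\<^sub>1\<close>) is removed, and for a connected graph the remaining eigenvalues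
  \<open>\<lambda>\<^sub>2, \<dots>, \<lambda>\<^sub>N\<close> are positive.
\<close>

definition H2 :: "'a pair_pre_digraph \<Rightarrow> real" where
  "H2 G = 1 / (2 * real (card (pverts G))) *
     (\<Sum>\<mu> \<in># laplacian_spectrum G - {#0#}. 1 / \<mu>^2)"

definition h_coeff :: "real \<Rightarrow> real" where
  "h_coeff x =
     (x^5 + 7 * x^4 + 16 * x^3 + 28 * x^2 + 26 * x + 12) * (x - 1) /
     (2 * x^2 * (x + 1)^2 * (x + 2)^2 * (x + 3) * (x^2 + 3 * x + 4))"

end

theory Submission
  imports Defs
begin

text \<open>
  Deleting the last letter maps \<open>\<S>(n+1,k)\<close> onto \<open>\<S>(n,k)\<close>. With \<open>B\<close> the
  incidence matrix of this map and \<open>\<sigma>\<close> the involution matching the ends of every edge that joins two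
  fibres (fixing the \<open>k\<close> extreme vertices), \<open>L\<^sub>n\<^sub>+\<^sub>1 = (k+1)I - BB\<^sup>T - \<sigma>\<close> and
  \<open>B\<^sup>T\<sigma>B = kI - L\<^sub>n\<close>. Since \<open>(yI + \<sigma>)\<^sup>-\<^sup>1 = (yI - \<sigma>)/(y\<^sup>2 - 1)\<close>, Sylvester's determinant identity
  expresses the characteristic polynomial of \<open>L\<^sub>n\<^sub>+\<^sub>1\<close> at \<open>x\<close> through that of \<open>L\<^sub>n\<close> at \<open>x(k+2-x)\<close>:
  every nonzero eigenvalue \<open>\<lambda>\<close> of \<open>L\<^sub>n\<close> yields the two roots of \<open>x\<^sup>2 - (k+2)x + \<lambda>\<close>, and the
  remaining eigenvalues are \<open>0\<close>, \<open>k\<close> and \<open>k+2\<close>. As all eigenvalues lie in \<open>[0, k+2]\<close>, these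
  roots are real, and the sums of \<open>1/\<lambda>\<close> and \<open>1/\<lambda>\<^sup>2\<close> obey linear recurrences in \<open>n\<close>.
\<close>

section \<open>Determinants of matrices indexed by lists\<close>

text \<open>Entries are functions of the list elements themselves, so matrix products become sums
  over sets of vertices and positions need not be tracked.\<close>

definition lmat :: "'a list \<Rightarrow> 'b list \<Rightarrow> ('a \<Rightarrow> 'b \<Rightarrow> 'c) \<Rightarrow> 'c mat" where
  "lmat us vs g = mat (length us) (length vs) (\<lambda>(i, j). g (us ! i) (vs ! j))"

lemma lmat_carrier [simp]: "lmat us vs g \<in> carrier_mat (length us) (length vs)"
  by (simp add: lmat_def)

lemma dim_lmat [simp]: "dim_row (lmat us vs g) = length us" "dim_col (lmat us vs g) = length vs"
  by (simp_all add: lmat_def)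

lemma lmat_cong:
  "(\<And>u v. u \<in> set us \<Longrightarrow> v \<in> set vs \<Longrightarrow> g u v = h u v) \<Longrightarrow> lmat us vs g = lmat us vs h"
  by (auto simp: lmat_def)

lemma lmat_add: "lmat us vs g + lmat us vs h = lmat us vs (\<lambda>u v. g u v + h u v)"
  by (auto simp: lmat_def)

lemma lmat_smult: "c \<cdot>\<^sub>m lmat us vs g = lmat us vs (\<lambda>u v. c * g u v)"
  by (auto simp: lmat_def)

lemma lmat_uminus: "- lmat us vs g = lmat us vs (\<lambda>u v. - g u v)"
  by (auto simp: lmat_def)

lemma lmat_one: "distinct us \<Longrightarrow> 1\<^sub>m (length us) = lmat us us (\<lambda>u v. of_bool (u = v))"
  by (auto simp: lmat_def one_mat_def nth_eq_iff_index_eq intro!: eq_matI)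

lemma lmat_mult:
  assumes "distinct vs"
  shows "lmat us vs g * lmat vs ws h = lmat us ws (\<lambda>u w. \<Sum>v\<in>set vs. g u v * h v w)"
proof (rule eq_matI)
  fix i j
  assume "i < dim_row (lmat us ws (\<lambda>u w. \<Sum>v\<in>set vs. g u v * h v w))"
    "j < dim_col (lmat us ws (\<lambda>u w. \<Sum>v\<in>set vs. g u v * h v w))"
  moreover have "(\<Sum>m<length vs. f (vs ! m)) = (\<Sum>v\<in>set vs. f v)" for f
    using assms by (intro sum.reindex_bij_betw bij_betw_nth) auto
  ultimately show "(lmat us vs g * lmat vs ws h) $$ (i, j) =
      lmat us ws (\<lambda>u w. \<Sum>v\<in>set vs. g u v * h v w) $$ (i, j)"
    by (simp add: lmat_def scalar_prod_def atLeast0LessThan)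
qed simp_all

text \<open>Reordering rows and columns by the same permutation brings in its sign twice, so
  determinants do not depend on how the vertices are listed.\<close>

lemma det_lmat_permute:
  fixes g :: "'a \<Rightarrow> 'a \<Rightarrow> 'b :: comm_ring_1"
  assumes "distinct us" "distinct vs" "set us = set vs"
  shows "det (lmat us us g) = det (lmat vs vs g)"
proof -
  let ?n = "length vs"
  have n: "length us = ?n"
    using assms by (metis distinct_card)
  have "mset us = mset vs"
    using assms by (simp add: set_eq_iff_mset_eq_distinct)
  then obtain p where p: "p permutes {..<?n}" "permute_list p vs = us"
    by (rule mset_eq_permutation)
  have us: "us ! i = vs ! p i" if "i < ?n" for i
    using p that by (metis permute_list_nth)
  have pn: "p permutes {0..<?n}"
    using p(1) by (simp add: atLeast0LessThan)
  have lt: "p i < ?n" if "i < ?n" for i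
    using p(1) that permutes_in_image by fastforce
  \<comment> \<open>\<open>A\<close> is the halfway stage, with rows listed as in \<open>vs\<close>
    and columns as in \<open>us\<close>; each half costs one factor \<open>signof p\<close>.\<close>
  define A where "A = mat ?n ?n (\<lambda>(i, j). g (vs ! i) (us ! j))"
  have A: "A \<in> carrier_mat ?n ?n"
    by (simp add: A_def)
  have "lmat us us g = mat ?n ?n (\<lambda>(i, j). A $$ (p i, j))"
    by (auto simp: lmat_def n A_def us lt intro!: eq_matI)
  then have 1: "det (lmat us us g) = signof p * det A"
    using det_permute_rows[OF A pn] by simp
  have T: "transpose_mat (lmat vs vs g) \<in> carrier_mat ?n ?n"
    by simp
  have "transpose_mat A = mat ?n ?n (\<lambda>(i, j). transpose_mat (lmat vs vs g) $$ (p i, j))"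
    by (auto simp: lmat_def n A_def us lt intro!: eq_matI)
  then have "det (transpose_mat A) = signof p * det (transpose_mat (lmat vs vs g))"
    using det_permute_rows[OF T pn] by simp
  then have 2: "det A = signof p * det (lmat vs vs g)"
    using det_transpose[OF A] det_transpose[of "lmat vs vs g" ?n] by simp
  show ?thesis
    unfolding 1 2 by (auto simp: sign_def)
qed

text \<open>Sylvester's identity: clearing the block B of \<open>?K\<close> by a unitriangular
  factor on the left leaves 1 + BC, on the right 1 + CB, and both have the determinant of
  \<open>?K\<close>.\<close>

lemma det_one_plus_mult_swap:
  fixes B :: "'a :: idom mat"
  assumes B: "B \<in> carrier_mat n m" and C: "C \<in> carrier_mat m n"
  shows "det (1\<^sub>m n + B * C) = det (1\<^sub>m m + C * B)"
proof -
  let ?K = "four_block_mat (1\<^sub>m m) (- C) B (1\<^sub>m n)"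
  have K: "?K \<in> carrier_mat (m + n) (m + n)"
    using B C by auto
  have lower: "four_block_mat (1\<^sub>m m) (0\<^sub>m m n) X (1\<^sub>m n) \<in> carrier_mat (m + n) (m + n)" 
      "det (four_block_mat (1\<^sub>m m) (0\<^sub>m m n) X (1\<^sub>m n)) = 1"
    if "X \<in> carrier_mat n m" for X :: "'a mat"
    using that by (auto simp: det_four_block_mat_upper_right_zero[of _ m _ n])
  have mB: "- B \<in> carrier_mat n m" and mC: "- C \<in> carrier_mat m n"
    using B C by auto
  have BC: "1\<^sub>m n + B * C \<in> carrier_mat n n" and CB: "1\<^sub>m m + C * B \<in> carrier_mat m m"
    using B C by auto
  have "four_block_mat (1\<^sub>m m) (0\<^sub>m m n) (- B) (1\<^sub>m n) * ?K =
      four_block_mat (1\<^sub>m m) (- C) (0\<^sub>m n m) (1\<^sub>m n + B * C)"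
    apply (subst mult_four_block_mat[OF one_carrier_mat zero_carrier_mat mB one_carrier_mat
        one_carrier_mat mC B one_carrier_mat])
    using B C mB mC apply (intro cong_four_block_mat)
       apply (auto simp: left_add_zero_mat right_add_zero_mat intro!: eq_matI)
    done
  then have 1: "det ?K = det (1\<^sub>m n + B * C)"
    using det_mult[OF lower(1)[OF mB] K] lower(2)[OF mB]
      det_four_block_mat_lower_left_zero[OF one_carrier_mat mC refl BC] by simp
  have "?K * four_block_mat (1\<^sub>m m) (0\<^sub>m m n) (- B) (1\<^sub>m n) =
      four_block_mat (1\<^sub>m m + C * B) (- C) (0\<^sub>m n m) (1\<^sub>m n)"
    apply (subst mult_four_block_mat[OF one_carrier_mat mC B one_carrier_mat 
        one_carrier_mat zero_carrier_mat mB one_carrier_mat])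
    using B C mB mC apply (intro cong_four_block_mat)
       apply (auto simp: left_add_zero_mat right_add_zero_mat intro!: eq_matI)
    done
  then have "det ?K = det (1\<^sub>m m + C * B)"
    using det_mult[OF K lower(1)[OF mB]] lower(2)[OF mB]
      det_four_block_mat_lower_left_zero[OF CB mC refl one_carrier_mat] by simp
  with 1 show ?thesis by simp
qed

lemma det_lmat_block:
  fixes g :: "'a \<Rightarrow> 'a \<Rightarrow> 'b :: idom"
  assumes "\<And>u v. u \<in> set us \<Longrightarrow> v \<in> set vs \<Longrightarrow> g u v = 0"
  shows "det (lmat (us @ vs) (us @ vs) g) = det (lmat us us g) * det (lmat vs vs g)"
proof -
  have "lmat (us @ vs) (us @ vs) g =
    four_block_mat (lmat us us g) (lmat us vs g) (lmat vs us g) (lmat vs vs g)"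
    by (auto simp: lmat_def nth_append intro!: eq_matI)
  moreover have "lmat us vs g = 0\<^sub>m (length us) (length vs)"
    using assms by (auto simp: lmat_def intro!: eq_matI)
  ultimately show ?thesis
    by (simp add: det_four_block_mat_upper_right_zero[of _ "length us" _ "length vs"])
qed

text \<open>Up to reordering, yI + \<sigma> is block diagonal, with a block y + 1 for every fixed
  point and a block of determinant y^2 - 1 for each of the \<open>m\<close> swapped pairs.\<close>

lemma det_lmat_involution:
  fixes y :: "'b :: idom"
  assumes "distinct us" "\<And>u. u \<in> set us \<Longrightarrow> \<sigma> u \<in> set us" "\<And>u. u \<in> set us \<Longrightarrow> \<sigma> (\<sigma> u) = u"
  shows "\<exists>m. length us = card {u \<in> set us. \<sigma> u = u} + 2 * m \<and>
    det (lmat us us (\<lambda>u v. y * of_bool (u = v) + of_bool (v = \<sigma> u))) =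
      (y + 1) ^ card {u \<in> set us. \<sigma> u = u} * (y\<^sup>2 - 1) ^ m"
  using assms
proof (induction "length us" arbitrary: us rule: less_induct)
  case less
  let ?g = "\<lambda>u v. y * of_bool (u = v) + of_bool (v = \<sigma> u)"
  show ?case
  proof (cases us)
    case Nil
    then show ?thesis by (simp add: lmat_def)
  next
    case (Cons a ws)
    show ?thesis
    proof (cases "\<sigma> a = a")
      case True
      have ws: "distinct ws" "\<And>u. u \<in> set ws \<Longrightarrow> \<sigma> u \<in> set ws" "\<And>u. u \<in> set ws \<Longrightarrow> \<sigma> (\<sigma> u) = u"
        using less.prems Cons True by fastforce+
      obtain m where m: "length ws = card {u \<in> set ws. \<sigma> u = u} + 2 * m"
        "det (lmat ws ws ?g) = (y + 1) ^ card {u \<in> set ws. \<sigma> u = u} * (y\<^sup>2 - 1) ^ m"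
        using less.hyps[OF _ ws] Cons by auto
      have F: "{u \<in> set us. \<sigma> u = u} = insert a {u \<in> set ws. \<sigma> u = u}"
        using Cons True by auto
      have "a \<notin> set ws" using less.prems Cons by auto
      then have c: "card {u \<in> set us. \<sigma> u = u} = Suc (card {u \<in> set ws. \<sigma> u = u})"
        by (simp add: F)
      have "det (lmat ([a] @ ws) ([a] @ ws) ?g) = det (lmat [a] [a] ?g) * det (lmat ws ws ?g)"
        using \<open>a \<notin> set ws\<close> True by (intro det_lmat_block) auto
      moreover have "det (lmat [a] [a] ?g) = y + 1"
        using True by (subst det_single) (auto simp: lmat_def)
      ultimately show ?thesis
        using m c Cons by (intro exI[of _ m]) simp
    next
      case False
      define b where "b = \<sigma> a"
      have ab: "a \<noteq> b" "\<sigma> a = b" "\<sigma> b = a" "b \<in> set ws"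
        using less.prems Cons False by (auto simp: b_def)
      define vs where "vs = remove1 b ws"
      have set_vs: "set vs = set us - {a, b}" "distinct vs" "set us = {a, b} \<union> set vs"
        using less.prems Cons ab by (auto simp: vs_def)
      have vs: "\<sigma> u \<in> set vs" "\<sigma> (\<sigma> u) = u" if "u \<in> set vs" for u
        using that less.prems(2,3) ab unfolding set_vs(1) by (metis DiffD1 DiffD2 DiffI insert_iff empty_iff)+
      have len: "length us = 2 + length vs"
        using Cons ab length_pos_if_in_set[of b ws] by (simp add: vs_def length_remove1)
      obtain m where m: "length vs = card {u \<in> set vs. \<sigma> u = u} + 2 * m"
        "det (lmat vs vs ?g) = (y + 1) ^ card {u \<in> set vs. \<sigma> u = u} * (y\<^sup>2 - 1) ^ m"
        using less.hyps[OF _ set_vs(2) vs] len by auto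
      have F: "{u \<in> set us. \<sigma> u = u} = {u \<in> set vs. \<sigma> u = u}"
        using set_vs ab by auto
      \<comment> \<open>Reordering brings the swapped pair to the front, where no entry links it to
        the remaining vertices.\<close>
      have "det (lmat us us ?g) = det (lmat ([a, b] @ vs) ([a, b] @ vs) ?g)"
        using set_vs less.prems ab by (intro det_lmat_permute) auto
      also have "\<dots> = det (lmat [a, b] [a, b] ?g) * det (lmat vs vs ?g)"
        using set_vs ab by (intro det_lmat_block) auto
      also have "lmat [a, b] [a, b] ?g =
          four_block_mat (lmat [a] [a] ?g) (lmat [a] [b] ?g) (lmat [b] [a] ?g) (lmat [b] [b] ?g)"
        by (auto simp: lmat_def nth_Cons' intro!: eq_matI)
      also have "det \<dots> = y\<^sup>2 - 1"
        using ab apply (subst det_four_block_mat[of _ 1])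
             apply (auto simp: lmat_def scalar_prod_def power2_eq_square intro!: eq_matI)
        apply (subst det_single)
         apply (auto simp: scalar_prod_def)
        done
      finally show ?thesis
        using m F len by (intro exI[of _ "Suc m"]) simp
    qed
  qed
qed

section \<open>The recursive structure of Sierpinski graphs\<close>

definition words :: "nat \<Rightarrow> nat \<Rightarrow> nat list set" where
  "words n k = {p. length p = n \<and> set p \<subseteq> {1..k}}"

text \<open>The bound \<open>n\<close> is read off from \<open>p\<close> and the alphabet is
  dropped, so that adjacency can be analysed by induction on the words.\<close>

definition adj :: "'a list \<Rightarrow> 'a list \<Rightarrow> bool" where
  "adj p q \<longleftrightarrow> (\<exists>h<length p. (\<forall>i<h. p ! i = q ! i) \<and> p ! h \<noteq> q ! h \<and>
     (\<forall>i. h < i \<and> i < length p \<longrightarrow> p ! i = q ! h \<and> q ! i = p ! h))"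

text \<open>
  The involution \<open>\<sigma>\<close>: it turns the ending \<open>a b\<^sup>m\<close> with \<open>a \<noteq> b\<close> and \<open>m > 0\<close> into \<open>b a\<^sup>m\<close> and
  fixes constant words.
\<close>

fun partner :: "'a list \<Rightarrow> 'a list" where
  "partner [] = []"
| "partner (a # p) =
    (if set p = {hd p} \<and> hd p \<noteq> a
     then hd p # replicate (length p) a else a # partner p)"

lemma pverts_sierpinski: "pverts (sierpinski n k) = words n k"
  by (simp add: sierpinski_def words_def Let_def)

lemma parcs_sierpinski:
  "(p, q) \<in> parcs (sierpinski n k) \<longleftrightarrow> p \<in> words n k \<and> q \<in> words n k \<and> adj p q"
  by (auto simp: sierpinski_def words_def adj_def Let_def)

lemma finite_words [simp]: "finite (words n k)"
  using finite_lists_length_eq[of "{1..k}" n] by (simp add: words_def conj_commute)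

lemma card_words: "card (words n k) = k ^ n"
  using card_lists_length_eq[of "{1..k}" n] by (simp add: words_def conj_commute)

lemma adj_irrefl [simp]: "\<not> adj p p"
  by (auto simp: adj_def)

lemma adj_Nil [simp]: "\<not> adj [] q"
  by (simp add: adj_def)

lemma eq_replicate_iff: "length p = m \<Longrightarrow> p = replicate m a \<longleftrightarrow> set p \<subseteq> {a}"
  by (metis empty_subsetI replicate_eqI set_replicate_conv_if singletonD subset_iff)

text \<open>If the first letters differ, the position \<open>h\<close> of the definition is 0, which
  forces all later letters; otherwise it lies in the tails.\<close>

lemma adj_Cons:
  assumes "length p = length q"
  shows "adj (a # p) (b # q) \<longleftrightarrow> (if a = b then adj p q else set p \<subseteq> {b} \<and> set q \<subseteq> {a})"
proof (cases "a = b")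
  case True
  have *: "(\<forall>i. Suc h < i \<and> i < Suc n \<longrightarrow> R i) \<longleftrightarrow> (\<forall>i. h < i \<and> i < n \<longrightarrow> R (Suc i))" for h n R
    by (auto simp: Suc_less_eq2)
  show ?thesis
    unfolding adj_def using True by (simp add: Ex_less_Suc2 All_less_Suc2 *)
next
  case False
  have "adj (a # p) (b # q) \<longleftrightarrow> (\<forall>i<length p. p ! i = b \<and> q ! i = a)"
    unfolding adj_def using False
    by (auto simp: Ex_less_Suc2 All_less_Suc2 gr0_conv_Suc)
  also have "\<dots> \<longleftrightarrow> set p \<subseteq> {b} \<and> set q \<subseteq> {a}"
    using assms by (auto simp: set_conv_nth)
  finally show ?thesis using False by simp
qed

section \<open>The partner involution and its fixed points\<close>

lemma length_partner [simp]: "length (partner p) = length p"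
  by (induction p) auto

lemma set_partner [simp]: "set (partner p) = set p"
  by (induction p) auto

lemma partner_const: "set p \<subseteq> {c} \<Longrightarrow> partner p = p"
  by (induction p) auto

lemma partner_partner [simp]: "partner (partner p) = p"
proof (induction p)
  case (Cons a p)
  show ?case
  proof (cases "set p = {hd p} \<and> hd p \<noteq> a")
    case True
    then have "p = replicate (length p) (hd p)" "p \<noteq> []"
      by (auto simp: eq_replicate_iff)
    with True show ?thesis by (cases p) auto
  next
    case False
    \<comment> \<open>\<open>p\<close> and \<open>partner p\<close> have the same letters and
      coincide if these are constant, so the second application takes the recursive branch
      too.\<close>
    then have "\<not> (set p = {hd (partner p)} \<and> hd (partner p) \<noteq> a)"
      using partner_const[of p "hd (partner p)"] by (metis order_refl)
    then have "partner (a # partner p) = a # partner (partner p)"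
      by (simp only: partner.simps set_partner if_False)
    moreover have "partner (a # p) = a # partner p"
      using False by auto
    ultimately show ?thesis using Cons by simp
  qed
qed simp

lemma partner_words [simp]: "partner p \<in> words n k \<longleftrightarrow> p \<in> words n k"
  by (simp add: words_def)

lemma partner_fixed_iff: "partner p = p \<longleftrightarrow> p = replicate (length p) (hd p)"
proof (induction p)
  case (Cons a p)
  then show ?case
    by (cases p) (auto simp: eq_replicate_iff)
qed simp

text \<open>The fixed points are the extreme vertices, one for each letter; for words of length 0
  there would be just one.\<close>

lemma card_partner_fixed: "card {p \<in> words (Suc n) k. partner p = p} = k"
proof -
  have "{p \<in> words (Suc n) k. partner p = p} = replicate (Suc n) ` {1..k}"
  proof (intro equalityI subsetI)
    fix p assume "p \<in> {p \<in> words (Suc n) k. partner p = p}"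
    then have p: "length p = Suc n" "set p \<subseteq> {1..k}" "p = replicate (Suc n) (hd p)"
      by (auto simp: words_def partner_fixed_iff)
    then have "hd p \<in> {1..k}"
      by (metis Zero_not_Suc hd_in_set list.size(3) subsetD)
    with p(3) show "p \<in> replicate (Suc n) ` {1..k}" by blast
  next
    fix p assume "p \<in> replicate (Suc n) ` {1..k}"
    then obtain x where "p = replicate (Suc n) x" "x \<in> {1..k}" by blast
    moreover from this have "partner p = p"
      by (intro partner_const[of p x]) auto
    ultimately show "p \<in> {p \<in> words (Suc n) k. partner p = p}"
      by (auto simp: words_def simp del: partner.simps)
  qed
  moreover have "inj_on (replicate (Suc n)) {1..k}"
    by (auto simp: inj_on_def)
  ultimately show ?thesis by (simp add: card_image del: replicate_Suc)
qed

text \<open>A proper exchange changes a letter in front of the last one and so leads into a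
  different fibre. This keeps the edges within fibres and those between fibres disjoint.\<close>

lemma butlast_partner_eq: "butlast (partner p) = butlast p \<Longrightarrow> partner p = p"
proof (induction p)
  case (Cons a p)
  then show ?case by (cases p) (auto split: if_splits)
qed simp

text \<open>An edge whose \<open>h\<close> is the last position stays in a fibre; for smaller
  \<open>h\<close> the endings are a b^m and b a^m with m > 0, which \<sigma> exchanges.\<close>

lemma adj_iff_partner:
  assumes "length p = length q"
  shows "adj p q \<longleftrightarrow> p \<noteq> q \<and> (butlast p = butlast q \<or> q = partner p)"
  using assms
proof (induction p q rule: list_induct2)
  case (Cons a p b q)
  show ?case
  proof (cases "p = []")
    case True
    with Cons show ?thesis by (auto simp: adj_Cons)
  next
    case False
    then have ne: "p \<noteq> []" "q \<noteq> []" using Cons.hyps by auto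
    show ?thesis
    proof (cases "a = b")
      case True
      \<comment> \<open>A constant \<open>p\<close> is its own partner, so no \<open>q\<close>
        different from \<open>p\<close> is lost when prefixing a letter makes \<open>partner\<close>
        exchange instead of recurse.\<close>
      have "q \<noteq> partner p" if "set p = {hd p}" "p \<noteq> q"
        using that partner_const[of p "hd p"] by auto
      with True ne Cons.IH Cons.hyps show ?thesis
        by (auto simp: adj_Cons)
    next
      case False
      have "set p \<subseteq> {b} \<longleftrightarrow> set p = {hd p} \<and> hd p = b"
        using ne by (cases p) auto
      with False ne Cons.hyps show ?thesis
        by (auto simp: adj_Cons eq_replicate_iff)
    qed
  qed
qed simp

text \<open>For adjacent \<open>p\<close> and \<open>q\<close> this letter, appended to
  \<open>p\<close>, gives the end in the fibre of \<open>p\<close> of the edge joining the two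
  fibres. The default is reached only by words without a common position of difference.\<close>

fun departure :: "'a list \<Rightarrow> 'a list \<Rightarrow> 'a" where
  "departure (a # p) (b # q) = (if a = b then departure p q else b)"
| "departure p q = undefined"

lemma departure_in_set: "length p = length q \<Longrightarrow> p \<noteq> q \<Longrightarrow> departure p q \<in> set q"
  by (induction p q rule: list_induct2) auto

text \<open>If p = u a b^m and q = u b a^m, then \<sigma> carries p b = u a b^(m+1) to u b a^(m+1),
  which lies over q, and no other appended letter does this. So each edge of the smaller graph comes
  from exactly one edge between fibres.\<close>

lemma butlast_partner_snoc:
  assumes "length p = length q" "p \<noteq> q"
  shows "butlast (partner (p @ [i])) = q \<longleftrightarrow> adj p q \<and> i = departure p q"
  using assms
proof (induction p q rule: list_induct2)
  case (Cons a p b q)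
  have snoc: "set (p @ [i]) = {hd (p @ [i])} \<longleftrightarrow> set p \<subseteq> {i}" "set p \<subseteq> {i} \<Longrightarrow> hd (p @ [i]) = i"
    by (cases p; auto)+
  show ?case
  proof (cases "a = b")
    case True
    \<comment> \<open>A constant \<open>p @ [i]\<close> is fixed by \<open>partner\<close>, so it
      stays over \<open>p\<close>.\<close>
    have "p = q" if "set p \<subseteq> {i}" "butlast (partner (p @ [i])) = q"
      using that partner_const[of "p @ [i]" i] by auto
    with True Cons snoc show ?thesis
      by (auto simp: adj_Cons)
  next
    case False
    have "butlast (replicate (Suc (length p)) a) = q \<longleftrightarrow> set q \<subseteq> {a}"
      using Cons.hyps eq_replicate_iff[of q "length p" a]
      by (simp only: replicate_Suc replicate_append_same[symmetric] butlast_snoc) metis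
    with False Cons.hyps snoc show ?thesis
      by (auto simp: adj_Cons)
  qed
qed simp

section \<open>Fibres of deleting the last letter, and the Laplacian\<close>

lemma fibre_words:
  assumes "v \<in> words n k"
  shows "{p \<in> words (Suc n) k. butlast p = v} = (\<lambda>i. v @ [i]) ` {1..k}"
proof (intro equalityI subsetI)
  fix p assume "p \<in> {p \<in> words (Suc n) k. butlast p = v}"
  then have p: "length p = Suc n" "set p \<subseteq> {1..k}" "butlast p = v" by (auto simp: words_def)
  then have "p \<noteq> []" by auto
  with p have "p = v @ [last p]" "last p \<in> {1..k}"
    using append_butlast_last_id[of p] subsetD[OF p(2) last_in_set[of p]] by auto
  then show "p \<in> (\<lambda>i. v @ [i]) ` {1..k}" by blast
qed (use assms in \<open>auto simp: words_def\<close>)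

lemma sum_fibre_words:
  assumes "v \<in> words n k"
  shows "(\<Sum>p\<in>words (Suc n) k. of_bool (butlast p = v) * f p) = (\<Sum>i\<in>{1..k}. f (v @ [i]) :: real)"
proof -
  have "(\<Sum>p\<in>words (Suc n) k. of_bool (butlast p = v) * f p) =
      (\<Sum>p\<in>{p \<in> words (Suc n) k. butlast p = v}. f p)"
    by (intro sum.mono_neutral_cong_right) auto
  also have "\<dots> = (\<Sum>i\<in>{1..k}. f (v @ [i]))"
    unfolding fibre_words[OF assms] by (subst sum.reindex) (auto simp: inj_on_def)
  finally show ?thesis .
qed

lemma butlast_words: "p \<in> words (Suc n) k \<Longrightarrow> butlast p \<in> words n k"
  by (auto simp: words_def dest: in_set_butlastD)

lemma snoc_words: "v \<in> words n k \<Longrightarrow> i \<in> {1..k} \<Longrightarrow> v @ [i] \<in> words (Suc n) k"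
  by (auto simp: words_def)

definition lap :: "nat \<Rightarrow> nat \<Rightarrow> nat list \<Rightarrow> nat list \<Rightarrow> real" where
  "lap n k p q = of_bool (p = q) * (\<Sum>r\<in>words n k. of_bool (adj p r)) - of_bool (adj p q)"

text \<open>The entrywise form of L = (k+1)I - BB^T - \<sigma>. A word has k - 1 neighbours in its
  fibre, and its partner if that differs; at a fixed word the missing neighbour is balanced by the
  diagonal entry of \<sigma>.\<close>

lemma lap_Suc:
  assumes p: "p \<in> words (Suc n) k" and q: "q \<in> words (Suc n) k"
  shows "lap (Suc n) k p q = (real k + 1) * of_bool (p = q) - of_bool (butlast p = butlast q)
    - of_bool (q = partner p)"
proof -
  \<comment> \<open>\<open>?g\<close> counts the whole fibre and the partner of \<open>p\<close>,
    hence also \<open>p\<close> itself, so its value at \<open>p\<close> is subtracted.\<close>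
  let ?g = "\<lambda>r. of_bool (butlast r = butlast p) + of_bool (r = partner p) :: real"
  have adj: "of_bool (adj p r) = ?g r - of_bool (r = p) * ?g p" if "r \<in> words (Suc n) k" for r
  proof -
    have "length p = length r" using p that by (simp add: words_def)
    then show ?thesis
      using butlast_partner_eq[of p] by (auto simp: adj_iff_partner)
  qed
  have "(\<Sum>r\<in>words (Suc n) k. of_bool (butlast r = butlast p)) = real k"
    using sum_fibre_words[OF butlast_words[OF p], of "\<lambda>_. 1"] by simp
  moreover have "(\<Sum>r\<in>words (Suc n) k. of_bool (r = partner p)) = (1 :: real)"
    using p by (simp add: of_bool_def)
  moreover have "(\<Sum>r\<in>words (Suc n) k. of_bool (r = p) * ?g p) = ?g p"
    using p by (simp add: of_bool_def if_distrib[of "\<lambda>x. x * _"] cong: if_cong)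
  ultimately have "(\<Sum>r\<in>words (Suc n) k. of_bool (adj p r)) = real k - of_bool (p = partner p)"
    by (simp add: adj sum_subtractf sum.distrib)
  then show ?thesis
    unfolding lap_def adj[OF q] by auto
qed

text \<open>The entrywise form of B^T \<sigma> B = kI - L. Off the diagonal only the letter
  \<open>departure\<close> can count, and only for adjacent words; the diagonal entry is what
  remains of the k letters.\<close>

lemma sum_partner_fibre:
  assumes v: "v \<in> words n k" and w: "w \<in> words n k"
  shows "(\<Sum>i\<in>{1..k}. of_bool (butlast (partner (v @ [i])) = w)) = real k * of_bool (v = w) - lap n k v w"
proof -
  define c where "c w = (\<Sum>i\<in>{1..k}. of_bool (butlast (partner (v @ [i])) = w) :: real)" for w
  have c: "c w = of_bool (adj v w)" if w: "w \<in> words n k" "v \<noteq> w" for w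
  proof -
    have l: "length v = length w" using v w by (simp add: words_def)
    then have "departure v w \<in> {1..k}"
      using departure_in_set[OF l w(2)] w(1) by (auto simp: words_def)
    then show ?thesis
      using w l by (simp add: c_def butlast_partner_snoc of_bool_conj of_bool_def)
  qed
  \<comment> \<open>Each of the k partners lies over exactly one word, so the row sum is k; this
    fixes the diagonal entry.\<close>
  have "(\<Sum>w\<in>words n k. c w) = (\<Sum>i\<in>{1..k}. \<Sum>w\<in>words n k. of_bool (butlast (partner (v @ [i])) = w))"
    unfolding c_def by (rule sum.swap)
  also have "\<dots> = (\<Sum>i\<in>{1..k}. 1)"
    using v by (intro sum.cong) (auto simp: of_bool_def butlast_words snoc_words)
  finally have "c v + (\<Sum>w\<in>words n k - {v}. c w) = real k"
    using v by (simp add: sum.remove)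
  moreover have "(\<Sum>w\<in>words n k - {v}. c w) = (\<Sum>w\<in>words n k. of_bool (adj v w))"
    using v c by (subst (2) sum.remove[of _ v]) (auto simp del: sum_of_bool_eq intro!: sum.cong)
  ultimately have "c v = real k - (\<Sum>w\<in>words n k. of_bool (adj v w))"
    by linarith
  then have "c w = real k * of_bool (v = w) - lap n k v w"
    using c[OF w] by (cases "v = w") (auto simp: lap_def)
  then show ?thesis unfolding c_def .
qed

section \<open>The recursion for the characteristic polynomial\<close>

lemma laplacian_sierpinski:
  obtains vs where "distinct vs" "set vs = words n k" "laplacian (sierpinski n k) = lmat vs vs (lap n k)"
proof
  let ?G = "sierpinski n k"
  let ?vs = "vertex_list ?G"
  have "\<exists>vs. distinct vs \<and> set vs = pverts ?G"
    using finite_distinct_list[of "words n k"] by (auto simp: pverts_sierpinski)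
  from someI_ex[OF this] show vs: "distinct ?vs" "set ?vs = words n k"
    by (simp_all add: vertex_list_def pverts_sierpinski)
  have deg: "real (out_degree (with_proj ?G) p) = (\<Sum>r\<in>words n k. of_bool (adj p r))"
    if "p \<in> words n k" for p
  proof -
    have "out_arcs (with_proj ?G) p = Pair p ` {r \<in> words n k. adj p r}"
      using that by (auto simp: out_arcs_def parcs_sierpinski)
    then have "out_degree (with_proj ?G) p = card {r \<in> words n k. adj p r}"
      by (simp add: out_degree_def card_image inj_on_def)
    also have "{r \<in> words n k. adj p r} = words n k \<inter> {r. adj p r}"
      by auto
    finally show ?thesis by simp
  qed
  have V: "?vs ! i \<in> words n k" if "i < length ?vs" for i
    using nth_mem[OF that] vs(2) by simp
  show "laplacian ?G = lmat ?vs ?vs (lap n k)"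
  proof (rule eq_matI)
    fix i j assume "i < dim_row (lmat ?vs ?vs (lap n k))" "j < dim_col (lmat ?vs ?vs (lap n k))"
    then have ij: "i < length ?vs" "j < length ?vs" by simp_all
    then have "i = j \<longleftrightarrow> ?vs ! i = ?vs ! j"
      using vs(1) by (simp add: nth_eq_iff_index_eq)
    then show "laplacian ?G $$ (i, j) = lmat ?vs ?vs (lap n k) $$ (i, j)"
      using ij V[OF ij(1)] V[OF ij(2)]
      by (simp add: laplacian_def degree_matrix_def adjacency_matrix_def Let_def lmat_def lap_def
          deg parcs_sierpinski del: sum_of_bool_eq)
  qed (simp_all add: laplacian_def degree_matrix_def adjacency_matrix_def Let_def)
qed

text \<open>Values at x turn the polynomial identity into one between real determinants, and
  \<open>det_lmat_permute\<close> replaces the chosen enumeration by any other.\<close>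

lemma poly_char_poly_laplacian:
  assumes "distinct vs" "set vs = words n k"
  shows "poly (char_poly (laplacian (sierpinski n k))) x =
    det (lmat vs vs (\<lambda>p q. x * of_bool (p = q) - lap n k p q))"
proof -
  obtain us where us: "distinct us" "set us = words n k"
    "laplacian (sierpinski n k) = lmat us us (lap n k)"
    by (rule laplacian_sierpinski)
  have "- char_matrix (lmat us us (lap n k)) x = lmat us us (\<lambda>p q. x * of_bool (p = q) - lap n k p q)"
    by (simp add: char_matrix_def lmat_one[OF us(1)] lmat_smult lmat_add lmat_uminus)
  then have "poly (char_poly (laplacian (sierpinski n k))) x =
      det (lmat us us (\<lambda>p q. x * of_bool (p = q) - lap n k p q))"
    unfolding us(3) by (subst char_poly_matrix) auto
  also have "\<dots> = det (lmat vs vs (\<lambda>p q. x * of_bool (p = q) - lap n k p q))"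
    using us assms by (intro det_lmat_permute) auto
  finally show ?thesis .
qed

text \<open>Factor out \<open>Y\<close>: Y + BC = Y(1 + ZBC), and Sylvester's identity moves the
  second determinant to size \<open>m\<close>.\<close>

lemma det_plus_mult:
  fixes B :: "'a :: idom mat"
  assumes Y: "Y \<in> carrier_mat n n" and Z: "Z \<in> carrier_mat n n" and YZ: "Y * Z = 1\<^sub>m n"
    and B: "B \<in> carrier_mat n m" and C: "C \<in> carrier_mat m n"
  shows "det (Y + B * C) = det Y * det (1\<^sub>m m + C * (Z * B))"
proof -
  have ZB: "Z * B \<in> carrier_mat n m" and BC: "B * C \<in> carrier_mat n n"
    and ZBC: "(Z * B) * C \<in> carrier_mat n n"
    using Z B C by auto
  have "Y * (1\<^sub>m n + (Z * B) * C) = Y * 1\<^sub>m n + Y * ((Z * B) * C)"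
    by (rule mult_add_distrib_mat[OF Y one_carrier_mat ZBC])
  also have "Y * ((Z * B) * C) = (Y * Z) * (B * C)"
    unfolding assoc_mult_mat[OF Z B C] assoc_mult_mat[OF Y Z BC] ..
  also have "\<dots> = B * C"
    unfolding YZ by (rule left_mult_one_mat[OF BC])
  finally have "det (Y + B * C) = det (Y * (1\<^sub>m n + (Z * B) * C))"
    using Y by simp
  also have "\<dots> = det Y * det (1\<^sub>m n + (Z * B) * C)"
    using ZBC by (intro det_mult[OF Y]) auto
  also have "det (1\<^sub>m n + (Z * B) * C) = det (1\<^sub>m m + C * (Z * B))"
    by (rule det_one_plus_mult_swap[OF ZB C])
  finally show ?thesis .
qed

lemma sum_of_bool_mult [simp]:
  fixes f :: "'a \<Rightarrow> 'b :: semiring_1"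
  assumes "finite A"
  shows "(\<Sum>q\<in>A. of_bool (q = a) * f q) = (if a \<in> A then f a else 0)"
    "(\<Sum>q\<in>A. of_bool (a = q) * f q) = (if a \<in> A then f a else 0)"
  using assms by (simp_all add: of_bool_def if_distrib[of "\<lambda>x. x * _"] cong: if_cong)

text \<open>A row of yI + \<sigma> or yI - \<sigma> acts on a function through two points only, also
  when these coincide.\<close>

lemma sum_two_points:
  fixes g :: "'a \<Rightarrow> 'b :: comm_ring_1"
  assumes "finite A" "a \<in> A" "b \<in> A"
  shows "(\<Sum>q\<in>A. (y * of_bool (a = q) + of_bool (q = b)) * g q) = y * g a + g b"
    "(\<Sum>q\<in>A. (y * of_bool (a = q) - of_bool (q = b)) * g q) = y * g a - g b"
  using assms
  by (simp_all add: distrib_right left_diff_distrib mult.assoc sum.distrib sum_subtractf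
      sum_distrib_left[symmetric])

text \<open>Here xI - L is Y + BC with Y = yI + \<sigma>, invertible as y^2 \<noteq> 1. Its
  determinant has \<open>k\<close> factors from fixed words and \<open>m\<close> from swapped pairs;
  the power with exponent \<open>k ^ n\<close> comes from scaling the matrix one level down.\<close>

lemma det_lap_Suc:
  fixes x :: real and k :: nat
  defines "y \<equiv> x - real k - 1"
  assumes vs: "distinct vs" "set vs = words n k" and ws: "distinct ws" "set ws = words (Suc n) k"
    and y: "y\<^sup>2 \<noteq> 1" and m: "k ^ Suc n = k + 2 * m"
  shows "det (lmat ws ws (\<lambda>p q. x * of_bool (p = q) - lap (Suc n) k p q)) =
    (y + 1) ^ k * (y\<^sup>2 - 1) ^ m * (- 1 / (y\<^sup>2 - 1)) ^ (k ^ n) *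
    det (lmat vs vs (\<lambda>p q. x * (real k + 2 - x) * of_bool (p = q) - lap n k p q))"
proof -
  let ?Y = "lmat ws ws (\<lambda>p q. y * of_bool (p = q) + of_bool (q = partner p))"
  let ?Z = "lmat ws ws (\<lambda>p q. (y * of_bool (p = q) - of_bool (q = partner p)) / (y\<^sup>2 - 1))"
  let ?B = "lmat ws vs (\<lambda>p v. of_bool (butlast p = v))"
  let ?C = "lmat vs ws (\<lambda>v p. of_bool (butlast p = v))"
  let ?N = "length ws"
  have len: "length vs = k ^ n" "length ws = k ^ Suc n"
    using vs ws distinct_card card_words by metis+
  have sw: "q = partner p \<longleftrightarrow> p = partner q" for p q :: "nat list"
    by auto
  have det_Y: "det ?Y = (y + 1) ^ k * (y\<^sup>2 - 1) ^ m"
    using det_lmat_involution[of ws partner y] ws m len(2) card_partner_fixed[of n k] by auto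
  have YZ: "?Y * ?Z = 1\<^sub>m ?N"
    unfolding lmat_mult[OF ws(1)] lmat_one[OF ws(1)]
  proof (rule lmat_cong)
    fix p r assume p: "p \<in> set ws" and r: "r \<in> set ws"
    let ?g = "\<lambda>q. (y * of_bool (q = r) - of_bool (r = partner q)) / (y\<^sup>2 - 1)"
    have "(\<Sum>q\<in>set ws. (y * of_bool (p = q) + of_bool (q = partner p)) * ?g q) =
        y * ?g p + ?g (partner p)"
      using p ws by (intro sum_two_points) auto
    also have "\<dots> = (y * (y * of_bool (p = r) - of_bool (r = partner p)) +
        (y * of_bool (r = partner p) - of_bool (p = r))) / (y\<^sup>2 - 1)"
      using sw[of r p] by (simp add: add_divide_distrib eq_commute)
    also have "\<dots> = of_bool (p = r) * ((y\<^sup>2 - 1) / (y\<^sup>2 - 1))"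
      by (simp add: algebra_simps power2_eq_square)
    also have "\<dots> = of_bool (p = r)"
      using y by simp
    finally show "(\<Sum>q\<in>set ws. (y * of_bool (p = q) + of_bool (q = partner p)) * ?g q) = of_bool (p = r)" .
  qed
  have lap_eq: "lmat ws ws (\<lambda>p q. x * of_bool (p = q) - lap (Suc n) k p q) = ?Y + ?B * ?C"
    unfolding lmat_mult[OF vs(1)] lmat_add
  proof (rule lmat_cong)
    fix p q assume pq: "p \<in> set ws" "q \<in> set ws"
    then have "(\<Sum>v\<in>set vs. of_bool (butlast p = v) * of_bool (butlast q = v)) =
        (of_bool (butlast p = butlast q) :: real)"
      using vs ws by (subst sum_of_bool_mult) (auto simp: butlast_words)
    then show "x * of_bool (p = q) - lap (Suc n) k p q = y * of_bool (p = q) + of_bool (q = partner p) +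
        (\<Sum>v\<in>set vs. of_bool (butlast p = v) * of_bool (butlast q = v))"
      using pq ws by (simp add: lap_Suc y_def algebra_simps)
  qed
  have det_eq: "det (?Y + ?B * ?C) = det ?Y * det (1\<^sub>m (length vs) + ?C * (?Z * ?B))"
    using YZ by (intro det_plus_mult[of _ ?N]) auto
  \<comment> \<open>B^T(yI - \<sigma>)B = kyI - (kI - L), so after adding I the coefficient of I has
    numerator y^2 - 1 + ky - k, which equals -x(k+2-x).\<close>
  have "1\<^sub>m (length vs) + ?C * (?Z * ?B) = (- 1 / (y\<^sup>2 - 1)) \<cdot>\<^sub>m
      lmat vs vs (\<lambda>p q. x * (real k + 2 - x) * of_bool (p = q) - lap n k p q)"
    unfolding lmat_mult[OF ws(1)] lmat_one[OF vs(1)] lmat_add lmat_smult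
  proof (rule lmat_cong)
    fix v w assume vw: "v \<in> set vs" "w \<in> set vs"
    have *: "(\<Sum>q\<in>set ws. (y * of_bool (p = q) - of_bool (q = partner p)) / (y\<^sup>2 - 1) * of_bool (butlast q = w)) =
        (y * of_bool (butlast p = w) - of_bool (butlast (partner p) = w)) / (y\<^sup>2 - 1)" if "p \<in> set ws" for p
    proof -
      have "(\<Sum>q\<in>set ws. (y * of_bool (p = q) - of_bool (q = partner p)) * of_bool (butlast q = w)) =
          y * of_bool (butlast p = w) - of_bool (butlast (partner p) = w)"
        using that ws by (intro sum_two_points) auto
      then show ?thesis
        by (simp only: times_divide_eq_left sum_divide_distrib[symmetric])
    qed
    have "(\<Sum>p\<in>set ws. of_bool (butlast p = v) *
        (\<Sum>q\<in>set ws. (y * of_bool (p = q) - of_bool (q = partner p)) / (y\<^sup>2 - 1) * of_bool (butlast q = w))) =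
        (\<Sum>p\<in>words (Suc n) k. of_bool (butlast p = v) *
          ((y * of_bool (butlast p = w) - of_bool (butlast (partner p) = w)) / (y\<^sup>2 - 1)))"
      using * ws by (intro sum.cong) auto
    also have "\<dots> = (\<Sum>i\<in>{1..k}. (y * of_bool (v = w) - of_bool (butlast (partner (v @ [i])) = w)) / (y\<^sup>2 - 1))"
      using vw vs by (subst sum_fibre_words) auto
    also have "\<dots> = (k * y * of_bool (v = w) - (\<Sum>i\<in>{1..k}. of_bool (butlast (partner (v @ [i])) = w))) / (y\<^sup>2 - 1)"
      by (simp add: sum_divide_distrib[symmetric] sum_subtractf)
    also have "\<dots> = (k * y * of_bool (v = w) - (real k * of_bool (v = w) - lap n k v w)) / (y\<^sup>2 - 1)"
      using vw vs by (subst sum_partner_fibre) auto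
    finally have *: "(\<Sum>p\<in>set ws. of_bool (butlast p = v) *
        (\<Sum>q\<in>set ws. (y * of_bool (p = q) - of_bool (q = partner p)) / (y\<^sup>2 - 1) * of_bool (butlast q = w))) =
        (k * y * of_bool (v = w) - (real k * of_bool (v = w) - lap n k v w)) / (y\<^sup>2 - 1)" .
    show "of_bool (v = w) + (\<Sum>p\<in>set ws. of_bool (butlast p = v) *
        (\<Sum>q\<in>set ws. (y * of_bool (p = q) - of_bool (q = partner p)) / (y\<^sup>2 - 1) * of_bool (butlast q = w))) =
        - 1 / (y\<^sup>2 - 1) * (x * (real k + 2 - x) * of_bool (v = w) - lap n k v w)"
    proof -
      define d where "d = y\<^sup>2 - 1"
      have d: "d \<noteq> 0" "x * (real k + 2 - x) = k - k * y - d"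
        using y by (simp_all add: d_def y_def algebra_simps power2_eq_square)
      have eq: "e + (k * y * e - (k * e - L)) / d = - 1 / d * ((k - k * y - d) * e - L)" for e L :: real
        using d(1) by (simp add: field_simps)
      show ?thesis
        unfolding * unfolding d_def[symmetric] d(2) by (rule eq)
    qed
  qed
  then have det_vs: "det (1\<^sub>m (length vs) + ?C * (?Z * ?B)) = (- 1 / (y\<^sup>2 - 1)) ^ (k ^ n) *
      det (lmat vs vs (\<lambda>p q. x * (real k + 2 - x) * of_bool (p = q) - lap n k p q))"
    by (simp only: det_smult dim_lmat len(1))
  show ?thesis
    unfolding lap_eq det_eq det_Y det_vs by (simp only: mult.assoc)
qed

text \<open>Each t contributes both roots a, b of x^2 - cx + t. They are real since t \<le> c and c
  \<ge> 4 give 4t \<le> c^2, and positive with sum c. By Vieta, 1/a + 1/b = c/t and 1/a^2 + 1/b^2 =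
  c^2/t^2 - 2/t.\<close>

lemma split_roots:
  fixes c :: real
  assumes "c \<ge> 4" "\<forall>t\<in>#M. 0 < t \<and> t \<le> c"
  obtains P where "size P = 2 * size M" "\<forall>\<mu>\<in>#P. 0 < \<mu> \<and> \<mu> \<le> c"
    "\<And>x. (\<Prod>\<mu>\<in>#P. x - \<mu>) = (\<Prod>t\<in>#M. x\<^sup>2 - c * x + t)"
    "(\<Sum>\<mu>\<in>#P. 1 / \<mu>) = c * (\<Sum>t\<in>#M. 1 / t)"
    "(\<Sum>\<mu>\<in>#P. 1 / \<mu>\<^sup>2) = c\<^sup>2 * (\<Sum>t\<in>#M. 1 / t\<^sup>2) - 2 * (\<Sum>t\<in>#M. 1 / t)"
  using assms(2)
proof (induction M arbitrary: thesis)
  case empty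
  show ?case by (rule empty(1)[of "{#}"]) auto
next
  case (add l M)
  obtain P where P: "size P = 2 * size M" "\<forall>\<mu>\<in>#P. 0 < \<mu> \<and> \<mu> \<le> c"
    "\<And>x. (\<Prod>\<mu>\<in>#P. x - \<mu>) = (\<Prod>t\<in>#M. x\<^sup>2 - c * x + t)"
    "(\<Sum>\<mu>\<in>#P. 1 / \<mu>) = c * (\<Sum>t\<in>#M. 1 / t)"
    "(\<Sum>\<mu>\<in>#P. 1 / \<mu>\<^sup>2) = c\<^sup>2 * (\<Sum>t\<in>#M. 1 / t\<^sup>2) - 2 * (\<Sum>t\<in>#M. 1 / t)"
    using add.IH add.prems(2) by auto
  have l: "0 < l" "l \<le> c"
    using add.prems(2) by auto
  have "4 * l \<le> c * c"
    using l assms(1) by (intro mult_mono) auto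
  define s where "s = sqrt (c\<^sup>2 - 4 * l)"
  have s: "s\<^sup>2 = c\<^sup>2 - 4 * l" "s \<ge> 0"
    using \<open>4 * l \<le> c * c\<close> by (simp_all add: s_def power2_eq_square)
  then have "s < c"
    using l assms(1) power2_less_imp_less[of s c] by simp
  define a b where "a = (c + s) / 2" and "b = (c - s) / 2"
  have ab: "a + b = c" "a * b = l" "0 < a" "0 < b" "a \<le> c" "b \<le> c"
  proof -
    have "a * b = (c\<^sup>2 - s\<^sup>2) / 4"
      by (simp add: a_def b_def power2_eq_square algebra_simps)
    then show "a * b = l" unfolding s(1) by simp
    show "a + b = c" "0 < a" "0 < b" "a \<le> c" "b \<le> c"
      using s(2) \<open>s < c\<close> unfolding a_def b_def by argo+
  qed
  have prod: "(x - a) * (x - b) = x\<^sup>2 - c * x + l" for x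
    unfolding ab(1,2)[symmetric] by (simp add: algebra_simps power2_eq_square)
  have inv: "1 / a + 1 / b = c * (1 / l)" "1 / a\<^sup>2 + 1 / b\<^sup>2 = c\<^sup>2 * (1 / l\<^sup>2) - 2 * (1 / l)"
    unfolding ab(1,2)[symmetric] using ab(3,4) by (simp_all add: field_simps power2_eq_square)
  show ?case
  proof (rule add.prems(1)[of "add_mset a (add_mset b P)"])
    show "(\<Prod>\<mu>\<in>#add_mset a (add_mset b P). x - \<mu>) = (\<Prod>t\<in>#add_mset l M. x\<^sup>2 - c * x + t)" for x
      using P(3)[of x] prod[of x] by (simp add: mult.assoc[symmetric])
    show "(\<Sum>\<mu>\<in>#add_mset a (add_mset b P). 1 / \<mu>) = c * (\<Sum>t\<in>#add_mset l M. 1 / t)"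
      using P(4) inv(1) by (simp add: distrib_left)
    show "(\<Sum>\<mu>\<in>#add_mset a (add_mset b P). 1 / \<mu>\<^sup>2) =
        c\<^sup>2 * (\<Sum>t\<in>#add_mset l M. 1 / t\<^sup>2) - 2 * (\<Sum>t\<in>#add_mset l M. 1 / t)"
      using P(5) inv(2) by (simp add: distrib_left)
  qed (use P(1,2) ab in auto)
qed

text \<open>Used because the determinant recursion excludes the points where y^2 = 1: a nonzero
  difference would have only finitely many roots.\<close>

lemma poly_eqI_cofinite:
  fixes p q :: "'a :: {idom, ring_char_0} poly"
  assumes "finite F" "\<And>x. x \<notin> F \<Longrightarrow> poly p x = poly q x"
  shows "p = q"
proof (rule ccontr)
  assume "p \<noteq> q"
  then have "finite {x. poly (p - q) x = 0}"
    by (intro poly_roots_finite) simp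
  moreover have "UNIV - F \<subseteq> {x. poly (p - q) x = 0}"
    using assms(2) by auto
  ultimately have "finite (UNIV :: 'a set)"
    using assms(1) by (metis finite_Diff2 finite_subset)
  then show False
    using infinite_UNIV_char_0 by blast
qed

section \<open>Multisets of nonzero eigenvalues\<close>

lemma poly_linear_factors: "poly (\<Prod>t\<in>#M. [:- t, 1:]) x = (\<Prod>t\<in>#M. x - t)"
  for x :: "'a :: comm_ring_1"
  by (simp add: poly_prod_mset)

lemma proots_linear_factors: "proots (\<Prod>t\<in>#M. [:- t, 1:]) = M"
  for M :: "'a :: idom multiset"
proof (induction M)
  case (add a M)
  have "(\<Prod>t\<in>#M. [:- t, 1:]) \<noteq> 0"
    by (auto simp: prod_mset_zero_iff)
  then show ?case
    using add by (simp add: proots_mult del: mult_pCons_left)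
qed simp

text \<open>\<open>M\<close> collects the nonzero eigenvalues, with one linear factor for 0 split
  off. The upper bound belongs to the invariant because it keeps the roots at the next level
  real.\<close>

definition spectral_factorization :: "nat \<Rightarrow> nat \<Rightarrow> real multiset \<Rightarrow> bool" where
  "spectral_factorization n k M \<longleftrightarrow>
    char_poly (laplacian (sierpinski n k)) = [:0, 1:] * (\<Prod>t\<in>#M. [:- t, 1:]) \<and>
    size M + 1 = k ^ n \<and> (\<forall>t\<in>#M. 0 < t \<and> t \<le> real k + 2)"

text \<open>The empty word is the single vertex and the Laplacian the 1 by 1 zero matrix. The
  induction starts here; its first step yields the complete graph on k vertices.\<close>

lemma spectral_factorization_0: "spectral_factorization 0 k {#}"
proof -
  have words: "set [[]] = words 0 k"
    by (auto simp: words_def)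
  have "poly (char_poly (laplacian (sierpinski 0 k))) x = x" for x
    unfolding poly_char_poly_laplacian[OF _ words, simplified]
    by (subst det_single) (auto simp: lmat_def lap_def)
  then have "char_poly (laplacian (sierpinski 0 k)) = [:0, 1:]"
    by (intro poly_eqI_cofinite[of "{}"]) auto
  then show ?thesis
    by (simp add: spectral_factorization_def)
qed

text \<open>The new spectrum consists of 0, the split roots, k with multiplicity E + k - 1 and k + 2
  with multiplicity E, where E is the excess of the number of swapped pairs over the size of
  \<open>M\<close>.\<close>

lemma spectral_factorization_Suc:
  assumes k: "k \<ge> 3" and M: "spectral_factorization n k M"
  obtains E M' where "spectral_factorization (Suc n) k M'" "2 * E = (k - 2) * (k ^ n - 1)"
    "(\<Sum>t\<in>#M'. 1 / t) = (real k + 2) * (\<Sum>t\<in>#M. 1 / t)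
       + (real E + real k - 1) / real k + real E / (real k + 2)"
    "(\<Sum>t\<in>#M'. 1 / t\<^sup>2) = (real k + 2)\<^sup>2 * (\<Sum>t\<in>#M. 1 / t\<^sup>2) - 2 * (\<Sum>t\<in>#M. 1 / t)
       + (real E + real k - 1) / (real k)\<^sup>2 + real E / (real k + 2)\<^sup>2"
proof -
  let ?c = "real k + 2"
  have char: "char_poly (laplacian (sierpinski n k)) = [:0, 1:] * (\<Prod>t\<in>#M. [:- t, 1:])"
    and size: "size M + 1 = k ^ n" and range: "\<forall>t\<in>#M. 0 < t \<and> t \<le> ?c"
    using M by (auto simp: spectral_factorization_def)
  obtain P where P: "size P = 2 * size M" "\<forall>\<mu>\<in>#P. 0 < \<mu> \<and> \<mu> \<le> ?c"
    "\<And>x. (\<Prod>\<mu>\<in>#P. x - \<mu>) = (\<Prod>t\<in>#M. x\<^sup>2 - ?c * x + t)"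
    "(\<Sum>\<mu>\<in>#P. 1 / \<mu>) = ?c * (\<Sum>t\<in>#M. 1 / t)"
    "(\<Sum>\<mu>\<in>#P. 1 / \<mu>\<^sup>2) = ?c\<^sup>2 * (\<Sum>t\<in>#M. 1 / t\<^sup>2) - 2 * (\<Sum>t\<in>#M. 1 / t)"
    using split_roots[OF _ range] k by auto
  have "even ((k - 2) * (k ^ n - 1))"
    using k by (cases "even k") auto
  then obtain E where E: "2 * E = (k - 2) * (k ^ n - 1)"
    by (metis evenE)
  \<comment> \<open>The number of swapped pairs: k(k^n - 1)/2 = (k^n - 1) + (k - 2)(k^n -
    1)/2.\<close>
  define m where "m = size M + E"
  have m: "k ^ Suc n = k + 2 * m"
  proof -
    obtain j where j: "k = j + 2" using k by (metis add.commute le_Suc_ex numeral_3_eq_3 Suc_leD numeral_2_eq_2)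
    have "2 * E = j * size M" using E size j by (metis add_diff_cancel_right')
    moreover have "k ^ Suc n = (j + 2) * (size M + 1)" using size j by simp
    ultimately show ?thesis by (simp add: j m_def algebra_simps)
  qed
  define M' where "M' = replicate_mset (E + (k - 1)) (real k) + replicate_mset E ?c + P"
  obtain vs where vs: "distinct vs" "set vs = words n k"
    using finite_distinct_list[OF finite_words] by blast
  obtain ws where ws: "distinct ws" "set ws = words (Suc n) k"
    using finite_distinct_list[OF finite_words] by blast
  have "char_poly (laplacian (sierpinski (Suc n) k)) = [:0, 1:] * (\<Prod>t\<in>#M'. [:- t, 1:])"
  proof (rule poly_eqI_cofinite[of "{real k, ?c}"])
    fix x assume x: "x \<notin> {real k, ?c}"
    define y where "y = x - real k - 1"
    define w where "w = (x - real k) * (x - ?c)"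
    have w: "y\<^sup>2 - 1 = w" "w \<noteq> 0" "y + 1 = x - real k"
      using x by (simp add: y_def w_def power2_eq_square algebra_simps, simp add: w_def, simp add: y_def)
    let ?Q = "\<Prod>t\<in>#M. x\<^sup>2 - ?c * x + t"
    have neg: "(\<Prod>t\<in>#M. - f t) = (- 1) ^ size M * (\<Prod>t\<in>#M. f t)" for f :: "real \<Rightarrow> real"
      by (induction M) auto
    have Q: "(\<Prod>t\<in>#M. x * (?c - x) - t) = (- 1) ^ size M * ?Q"
      unfolding neg[symmetric] by (simp add: algebra_simps power2_eq_square)
    have "poly (char_poly (laplacian (sierpinski (Suc n) k))) x =
        (x - real k) ^ k * w ^ m * (- 1 / w) ^ (k ^ n) * poly (char_poly (laplacian (sierpinski n k))) (x * (?c - x))"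
      unfolding poly_char_poly_laplacian[OF vs] poly_char_poly_laplacian[OF ws]
      using det_lap_Suc[OF vs ws _ m, of x, folded y_def] w by simp
    also have "\<dots> = (x - real k) ^ k * w ^ m * (- 1 / w) ^ (size M + 1) * (x * (?c - x) * ((- 1) ^ size M * ?Q))"
      unfolding char poly_mult poly_linear_factors Q size by simp
    also have "\<dots> = (x - real k) ^ k * (w ^ m / w ^ size M) * (x * (x - ?c) / w) * ?Q"
    proof -
      \<comment> \<open>The sign from each of the \<open>size M\<close> quadratic factors cancels
        against one in -1/w; the sign left over turns c - x into x - c.\<close>
      have "(- 1 / w) ^ (size M + 1) * (- 1) ^ size M = - 1 / w * ((- 1 / w) * - 1) ^ size M"
        by (simp only: power_add power_one_right power_mult_distrib mult_ac)
      also have "\<dots> = - 1 / w / w ^ size M"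
        by (simp add: power_divide)
      finally have sign: "(- 1 / w) ^ (size M + 1) * (- 1) ^ size M = - 1 / w / w ^ size M" .
      have "(x - real k) ^ k * w ^ m * (- 1 / w) ^ (size M + 1) * (x * (?c - x) * ((- 1) ^ size M * ?Q)) =
          (x - real k) ^ k * w ^ m * ((- 1 / w) ^ (size M + 1) * (- 1) ^ size M) * (x * (?c - x)) * ?Q"
        by (simp only: mult_ac)
      also have "\<dots> = (x - real k) ^ k * (w ^ m / w ^ size M) * (x * (x - ?c) / w) * ?Q"
        unfolding sign using w by (simp add: divide_simps) (simp add: algebra_simps)
      finally show ?thesis .
    qed
    also have "w ^ m / w ^ size M = w ^ E"
      using w by (simp add: m_def power_add)
    \<comment> \<open>The eigenvalue 0 becomes x(c - x), whose root c cancels against w; the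
      remaining denominator x - k lowers the multiplicity of k by one.\<close>
    also have "x * (x - ?c) / w = x / (x - real k)"
      using x by (simp add: w_def)
    also have "(x - real k) ^ k = (x - real k) ^ (k - 1) * (x - real k)"
      using k by (simp flip: power_Suc2)
    also have "(x - real k) ^ (k - 1) * (x - real k) * w ^ E * (x / (x - real k)) * ?Q =
        x * ((x - real k) ^ (E + (k - 1)) * (x - ?c) ^ E * ?Q)"
      using x by (simp add: w_def power_mult_distrib power_add)
    also have "\<dots> = poly ([:0, 1:] * (\<Prod>t\<in>#M'. [:- t, 1:])) x"
      unfolding poly_mult poly_linear_factors M'_def image_mset_union prod_mset_Un P(3)
      by simp
    finally show "poly (char_poly (laplacian (sierpinski (Suc n) k))) x =
      poly ([:0, 1:] * (\<Prod>t\<in>#M'. [:- t, 1:])) x" .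
  qed simp
  moreover have "size M' + 1 = k ^ Suc n"
    using P(1) k unfolding m m_def M'_def by simp
  moreover have "\<forall>t\<in>#M'. 0 < t \<and> t \<le> ?c"
    using P(2) k by (auto simp: M'_def in_replicate_mset)
  ultimately have "spectral_factorization (Suc n) k M'"
    by (simp add: spectral_factorization_def)
  then show thesis
  proof (rule that[OF _ E])
    show "(\<Sum>t\<in>#M'. 1 / t) = ?c * (\<Sum>t\<in>#M. 1 / t) + (real E + real k - 1) / real k + real E / ?c"
      using k by (simp add: M'_def P(4) of_nat_diff add_divide_distrib diff_divide_distrib)
    show "(\<Sum>t\<in>#M'. 1 / t\<^sup>2) = ?c\<^sup>2 * (\<Sum>t\<in>#M. 1 / t\<^sup>2) - 2 * (\<Sum>t\<in>#M. 1 / t)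
        + (real E + real k - 1) / (real k)\<^sup>2 + real E / ?c\<^sup>2"
      using k by (simp add: M'_def P(5) of_nat_diff add_divide_distrib diff_divide_distrib)
  qed
qed

text \<open>The split-off linear factor accounts for exactly the copy of 0 that \<open>H2\<close>
  removes.\<close>

lemma H2_eq_of_spectral_factorization:
  assumes "spectral_factorization n k M"
  shows "H2 (sierpinski n k) = (\<Sum>t\<in>#M. 1 / t\<^sup>2) / (2 * real k ^ n)"
proof -
  have "(\<Prod>t\<in>#M. [:- t, 1:]) \<noteq> 0"
    by (auto simp: prod_mset_zero_iff)
  then have "laplacian_spectrum (sierpinski n k) = {#0#} + M"
    using assms
    by (simp add: laplacian_spectrum_def spectral_factorization_def proots_mult proots_linear_factors
        del: mult_pCons_left)
  then show ?thesis
    unfolding H2_def pverts_sierpinski card_words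
    by (simp only: add_diff_cancel_left' times_divide_eq_left mult_1 of_nat_power)
qed

section \<open>Closed forms\<close>

text \<open>
  Undetermined coefficients for the recurrences: with \<open>X = k\<^sup>n\<close> and \<open>Z = (k + 2)\<^sup>n\<close>, the sum of
  \<open>1/\<lambda>\<close> is a combination of \<open>1, X, Z\<close>, and that of \<open>1/\<lambda>\<^sup>2\<close> one of \<open>1, X, Z, Z\<^sup>2\<close>.
\<close>

definition inv_coeff_1 :: "real \<Rightarrow> real" where
  "inv_coeff_1 x = - 2 / ((x + 1) * (x + 2))"

definition inv_coeff_X :: "real \<Rightarrow> real" where
  "inv_coeff_X x = - ((x - 2) * (x + 1)) / (2 * x * (x + 2))"

definition sq_coeff_1 :: "real \<Rightarrow> real" where
  "sq_coeff_1 x = - (7 * x^2 + 13 * x + 2) / (x * (x + 1)^2 * (x + 2)^2 * (x + 3))"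

definition sq_coeff_X :: "real \<Rightarrow> real" where
  "sq_coeff_X x = - ((x - 2) * (x^3 + 4 * x^2 + 4 * x + 2)) / (x^2 * (x + 2)^2 * (x^2 + 3 * x + 4))"

definition sq_coeff_Z :: "real \<Rightarrow> real" where
  "sq_coeff_Z x = (x - 1) * (x^2 + x + 2) / (x * (x + 1)^2 * (x + 2)^2)"

text \<open>The lemmas from \<open>inv_coeff_1_rec\<close> to \<open>sq_coeff_Z_rec\<close> compare
  coefficients of 1, X and Z in the recurrences once E = (x - 2)(X - 1)/2 is inserted. The top
  terms, in Z and in Z^2, just scale by x + 2 and (x + 2)^2.\<close>

lemma inv_coeff_1_rec:
  "x > 0 \<Longrightarrow> inv_coeff_1 x = (x + 2) * inv_coeff_1 x + x / (2 * x) - (x - 2) / (2 * (x + 2))"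
  unfolding inv_coeff_1_def by (simp add: divide_simps) (simp add: algebra_simps power_numeral_reduce)

lemma inv_coeff_X_rec:
  "x > 0 \<Longrightarrow> x * inv_coeff_X x = (x + 2) * inv_coeff_X x + (x - 2) / (2 * x) + (x - 2) / (2 * (x + 2))"
  unfolding inv_coeff_X_def by (simp add: divide_simps) (simp add: algebra_simps power_numeral_reduce)

lemma sq_coeff_1_rec:
  "x > 0 \<Longrightarrow> sq_coeff_1 x =
    (x + 2)^2 * sq_coeff_1 x - 2 * inv_coeff_1 x + x / (2 * x^2) - (x - 2) / (2 * (x + 2)^2)"
  unfolding sq_coeff_1_def inv_coeff_1_def by (simp add: divide_simps) (simp add: algebra_simps power_numeral_reduce)

lemma sq_coeff_X_rec:
  assumes "x > 0"
  shows "x * sq_coeff_X x =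
    (x + 2)^2 * sq_coeff_X x - 2 * inv_coeff_X x + (x - 2) / (2 * x^2) + (x - 2) / (2 * (x + 2)^2)"
proof -
  have "x^2 + 3 * x + 4 > 0" using assms by (simp add: add_pos_pos)
  then show ?thesis
    using assms unfolding sq_coeff_X_def inv_coeff_X_def by (simp add: divide_simps) (simp add: algebra_simps power_numeral_reduce)
qed

lemma sq_coeff_Z_rec:
  "x > 0 \<Longrightarrow> (x + 2) * sq_coeff_Z x = (x + 2)^2 * sq_coeff_Z x + 2 * (inv_coeff_1 x + inv_coeff_X x)"
  unfolding sq_coeff_Z_def inv_coeff_1_def inv_coeff_X_def by (simp add: divide_simps) (simp add: algebra_simps power_numeral_reduce)

text \<open>The initial condition: at n = 0 there is no nonzero eigenvalue, so the four coefficients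
  sum to 0, which determines the one of Z^2.\<close>

lemma sq_coeff_sum:
  assumes "x > 0"
  shows "sq_coeff_1 x + sq_coeff_X x + sq_coeff_Z x + 2 * h_coeff x = 0"
proof -
  have "x^2 + 3 * x + 4 > 0" using assms by (simp add: add_pos_pos)
  then show ?thesis
    using assms unfolding sq_coeff_1_def sq_coeff_X_def sq_coeff_Z_def h_coeff_def
    by (simp add: divide_simps) (simp add: algebra_simps power_numeral_reduce)
qed

lemma sum_mset_inverse_spectrum:
  assumes k: "k \<ge> 3"
  shows "\<exists>M. spectral_factorization n k M \<and>
    (\<Sum>t\<in>#M. 1 / t) = inv_coeff_1 k + inv_coeff_X k * real k ^ n
      - (inv_coeff_1 k + inv_coeff_X k) * (real k + 2) ^ n \<and>
    (\<Sum>t\<in>#M. 1 / t\<^sup>2) = sq_coeff_1 k + sq_coeff_X k * real k ^ n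
      + sq_coeff_Z k * (real k + 2) ^ n + 2 * h_coeff k * ((real k + 2) ^ n)\<^sup>2"
proof (induction n)
  case 0
  show ?case
    using k spectral_factorization_0[of k] sq_coeff_sum[of k] by (intro exI[of _ "{#}"]) simp
next
  case (Suc n)
  then obtain M where M: "spectral_factorization n k M"
    and s1: "(\<Sum>t\<in>#M. 1 / t) = inv_coeff_1 k + inv_coeff_X k * real k ^ n
      - (inv_coeff_1 k + inv_coeff_X k) * (real k + 2) ^ n"
    and s2: "(\<Sum>t\<in>#M. 1 / t\<^sup>2) = sq_coeff_1 k + sq_coeff_X k * real k ^ n
      + sq_coeff_Z k * (real k + 2) ^ n + 2 * h_coeff k * ((real k + 2) ^ n)\<^sup>2"
    by blast
  obtain E M' where M': "spectral_factorization (Suc n) k M'" "2 * E = (k - 2) * (k ^ n - 1)"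
    "(\<Sum>t\<in>#M'. 1 / t) = (real k + 2) * (\<Sum>t\<in>#M. 1 / t)
       + (real E + real k - 1) / real k + real E / (real k + 2)"
    "(\<Sum>t\<in>#M'. 1 / t\<^sup>2) = (real k + 2)\<^sup>2 * (\<Sum>t\<in>#M. 1 / t\<^sup>2) - 2 * (\<Sum>t\<in>#M. 1 / t)
       + (real E + real k - 1) / (real k)\<^sup>2 + real E / (real k + 2)\<^sup>2"
    by (rule spectral_factorization_Suc[OF k M])
  define x X Z where "x = real k" and "X = x ^ n" and "Z = (x + 2) ^ n"
  have x: "x > 0" using k by (simp add: x_def)
  have "2 * real E = (x - 2) * (X - 1)"
    using arg_cong[OF M'(2), of real] k by (simp add: of_nat_diff x_def X_def)
  then have "real E = (x - 2) * (X - 1) / 2"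
    by simp
  also have "\<dots> = (x - 2) / 2 * X - (x - 2) / 2"
    by (simp add: right_diff_distrib diff_divide_distrib)
  finally have E: "real E = (x - 2) / 2 * X - (x - 2) / 2" .
  note s1 = s1[folded x_def, folded X_def Z_def] and s2 = s2[folded x_def, folded X_def Z_def]
    and M' = M'(1) M'(3,4)[folded x_def]
  have "(\<Sum>t\<in>#M'. 1 / t) = ((x + 2) * inv_coeff_1 x + x / (2 * x) - (x - 2) / (2 * (x + 2))) +
      ((x + 2) * inv_coeff_X x + (x - 2) / (2 * x) + (x - 2) / (2 * (x + 2))) * X -
      (inv_coeff_1 x + inv_coeff_X x) * ((x + 2) * Z)"
  proof -
    \<comment> \<open>With the two reciprocals as plain variables, the comparison is a polynomial
      identity.\<close>
    define r s where "r = 1 / x" and "s = 1 / (x + 2)"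
    have div: "a / x = a * r" "a / (2 * x) = a / 2 * r"
      "a / (x + 2) = a * s" "a / (2 * (x + 2)) = a / 2 * s" for a
      by (simp_all add: r_def s_def)
    show ?thesis
      unfolding M'(2) s1 E div by (simp add: field_simps)
  qed
  moreover have "(\<Sum>t\<in>#M'. 1 / t\<^sup>2) =
      ((x + 2)\<^sup>2 * sq_coeff_1 x - 2 * inv_coeff_1 x + x / (2 * x\<^sup>2) - (x - 2) / (2 * (x + 2)\<^sup>2)) +
      ((x + 2)\<^sup>2 * sq_coeff_X x - 2 * inv_coeff_X x + (x - 2) / (2 * x\<^sup>2) + (x - 2) / (2 * (x + 2)\<^sup>2)) * X +
      ((x + 2)\<^sup>2 * sq_coeff_Z x + 2 * (inv_coeff_1 x + inv_coeff_X x)) * Z +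
      2 * h_coeff x * ((x + 2) * Z)\<^sup>2"
  proof -
    define r s where "r = 1 / x\<^sup>2" and "s = 1 / (x + 2)\<^sup>2"
    have div: "a / x\<^sup>2 = a * r" "a / (2 * x\<^sup>2) = a / 2 * r"
      "a / (x + 2)\<^sup>2 = a * s" "a / (2 * (x + 2)\<^sup>2) = a / 2 * s" for a
      by (simp_all add: r_def s_def)
    show ?thesis
      unfolding M'(3) s1 s2 E div by (simp add: field_simps power2_eq_square)
  qed
  ultimately show ?case
    using M'(1) inv_coeff_1_rec[OF x] inv_coeff_X_rec[OF x] sq_coeff_1_rec[OF x] sq_coeff_X_rec[OF x]
      sq_coeff_Z_rec[OF x]
    unfolding x_def[symmetric] power_Suc X_def[symmetric] Z_def[symmetric]
    by (intro exI[of _ M'] conjI) (simp_all add: mult_ac)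
qed

section \<open>The closed form of \<open>H2\<close> and its growth\<close>

lemma H2_sierpinski:
  assumes "k \<ge> 3"
  shows "H2 (sierpinski n k) = (sq_coeff_1 k + sq_coeff_X k * real k ^ n
      + sq_coeff_Z k * (real k + 2) ^ n + 2 * h_coeff k * ((real k + 2) ^ n)\<^sup>2) / (2 * real k ^ n)"
  using sum_mset_inverse_spectrum[OF assms, of n] H2_eq_of_spectral_factorization by metis

lemma h_coeff_pos: "x > 1 \<Longrightarrow> h_coeff x > 0"
  unfolding h_coeff_def by (intro divide_pos_pos mult_pos_pos add_pos_pos zero_less_power) auto

lemma H2_sierpinski_asymp:
  assumes k: "k \<ge> 3"
  shows "(\<lambda>n. H2 (sierpinski n k) / (h_coeff k * ((real k + 2)\<^sup>2 / real k) ^ n)) \<longlonglongrightarrow> 1"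
proof -
  define x where "x = real k"
  have x: "x \<ge> 3" "h_coeff x > 0"
    using k h_coeff_pos[of x] by (auto simp: x_def)
  \<comment> \<open>Dividing by the leading term h Z^2/X leaves 1 plus terms of orders 1/Z^2, X/Z^2
    and 1/Z.\<close>
  have "H2 (sierpinski n k) / (h_coeff k * ((real k + 2)\<^sup>2 / real k) ^ n) =
      (sq_coeff_1 x * (1 / (x + 2)\<^sup>2) ^ n + sq_coeff_X x * (x / (x + 2)\<^sup>2) ^ n
        + sq_coeff_Z x * (1 / (x + 2)) ^ n) / (2 * h_coeff x) + 1" for n
  proof -
    define X Z where "X = x ^ n" and "Z = (x + 2) ^ n"
    have "X > 0" "Z > 0" using x by (simp_all add: X_def Z_def)
    have pow: "(1 / (x + 2)\<^sup>2) ^ n = 1 / Z\<^sup>2" "(x / (x + 2)\<^sup>2) ^ n = X / Z\<^sup>2"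
      "((x + 2)\<^sup>2 / x) ^ n = Z\<^sup>2 / X" "(1 / (x + 2)) ^ n = 1 / Z"
      by (simp_all add: X_def Z_def power_divide power_mult[symmetric] mult.commute)
    show ?thesis
      unfolding H2_sierpinski[OF k] x_def[symmetric] pow X_def[symmetric] Z_def[symmetric]
      using \<open>h_coeff x > 0\<close> \<open>X > 0\<close> \<open>Z > 0\<close> by (simp add: field_simps power2_eq_square)
  qed
  moreover have lims: "(\<lambda>n. (1 / (x + 2)\<^sup>2) ^ n) \<longlonglongrightarrow> 0" "(\<lambda>n. (1 / (x + 2)) ^ n) \<longlonglongrightarrow> 0"
    "(\<lambda>n. (x / (x + 2)\<^sup>2) ^ n) \<longlonglongrightarrow> 0"
    using x by (intro LIMSEQ_realpow_zero; simp add: power2_eq_square algebra_simps add_strict_increasing)+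
  have "(\<lambda>n. (sq_coeff_1 x * (1 / (x + 2)\<^sup>2) ^ n + sq_coeff_X x * (x / (x + 2)\<^sup>2) ^ n
        + sq_coeff_Z x * (1 / (x + 2)) ^ n) / (2 * h_coeff x) + 1) \<longlonglongrightarrow>
      (sq_coeff_1 x * 0 + sq_coeff_X x * 0 + sq_coeff_Z x * 0) / (2 * h_coeff x) + 1"
    using x by (intro tendsto_add tendsto_divide tendsto_mult tendsto_const lims) auto
  ultimately show ?thesis
    by simp
qed

theorem theoremV4:
  fixes k :: nat
  assumes "k \<ge> 3"
  shows "(\<forall>n\<ge>1. card (pverts (sierpinski n k)) = k ^ n) \<and>
    (\<forall>n\<ge>1. let x = real k in
      H2 (sierpinski n k) =
        - ((7 * x^2 + 13 * x + 2) / (2 * x^(n+1) * (x + 1)^2 * (x + 2)^2 * (x + 3)))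
        - ((x - 2) * (x^3 + 4 * x^2 + 4 * x + 2)) / (2 * x^2 * (x + 2)^2 * (x^2 + 3 * x + 4))
        + ((x - 1) * (x + 2) powi (int n - 2) * (x^2 + x + 2)) / (2 * x^(n+1) * (x + 1)^2)
        + (x^5 + 7 * x^4 + 16 * x^3 + 28 * x^2 + 26 * x + 12)
            / (2 * x^(n+2) * (x + 1)^2 * (x + 3) * (x^2 + 3 * x + 4))
            * (x - 1) * (x + 2) powi (2 * int n - 2)) \<and>
    (\<lambda>n. H2 (sierpinski n k) /
        (h_coeff (real k) *
          real (card (pverts (sierpinski n k))) powr (2 * ln (real k + 2) / ln (real k) - 1)))
      \<longlonglongrightarrow> 1"
proof -
  define x where "x = real k"
  have x: "x \<ge> 3" using assms by (simp add: x_def)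
  have card: "card (pverts (sierpinski n k)) = k ^ n" for n
    by (simp add: pverts_sierpinski card_words)
  have "H2 (sierpinski n k) =
        - ((7 * x^2 + 13 * x + 2) / (2 * x^(n+1) * (x + 1)^2 * (x + 2)^2 * (x + 3)))
        - ((x - 2) * (x^3 + 4 * x^2 + 4 * x + 2)) / (2 * x^2 * (x + 2)^2 * (x^2 + 3 * x + 4))
        + ((x - 1) * (x + 2) powi (int n - 2) * (x^2 + x + 2)) / (2 * x^(n+1) * (x + 1)^2)
        + (x^5 + 7 * x^4 + 16 * x^3 + 28 * x^2 + 26 * x + 12)
            / (2 * x^(n+2) * (x + 1)^2 * (x + 3) * (x^2 + 3 * x + 4))
            * (x - 1) * (x + 2) powi (2 * int n - 2)" for n
  proof -
    define X Z where "X = x ^ n" and "Z = (x + 2) ^ n"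
    have X: "X > 0" using x by (simp add: X_def)
    \<comment> \<open>At n = 1 the exponent n - 2 is negative, hence the integer powers; both reduce
      to natural powers over (x + 2)^2.\<close>
    have powi: "(x + 2) powi (int n - 2) = Z / (x + 2)^2" "(x + 2) powi (2 * int n - 2) = Z^2 / (x + 2)^2"
      using x by (simp_all add: power_int_diff Z_def power_int_mult power_mult[symmetric] mult.commute)
    have pow: "x^(n+1) = X * x" "x^(n+2) = X * x^2"
      by (simp_all add: X_def power_add power2_eq_square)
    have terms: "sq_coeff_1 x / (2 * X) =
        - ((7 * x^2 + 13 * x + 2) / (2 * (X * x) * (x + 1)^2 * (x + 2)^2 * (x + 3)))" (is ?thesis1)
      "sq_coeff_X x * X / (2 * X) =
        - (((x - 2) * (x^3 + 4 * x^2 + 4 * x + 2)) / (2 * x^2 * (x + 2)^2 * (x^2 + 3 * x + 4)))" (is ?thesis2)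
      "sq_coeff_Z x * Z / (2 * X) =
        ((x - 1) * (Z / (x + 2)^2) * (x^2 + x + 2)) / (2 * (X * x) * (x + 1)^2)" (is ?thesis3)
      "2 * h_coeff x * Z^2 / (2 * X) = (x^5 + 7 * x^4 + 16 * x^3 + 28 * x^2 + 26 * x + 12)
          / (2 * (X * x^2) * (x + 1)^2 * (x + 3) * (x^2 + 3 * x + 4)) * (x - 1) * (Z^2 / (x + 2)^2)" (is ?thesis4)
    proof -
      have cancel: "a * X / (2 * X) = a / 2" "2 * a * b / (2 * X) = a * b / X" for a b
        using X by simp_all
      show ?thesis1 ?thesis2 ?thesis3 ?thesis4
        unfolding cancel unfolding sq_coeff_1_def sq_coeff_X_def sq_coeff_Z_def h_coeff_def
        by (simp_all only: minus_divide_left times_divide_eq_left times_divide_eq_right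
            divide_divide_eq_left mult_ac)
    qed
    show ?thesis
      unfolding H2_sierpinski[OF assms] x_def[symmetric] X_def[symmetric] Z_def[symmetric] powi pow
        add_divide_distrib terms by (simp only: diff_conv_add_uminus minus_divide_left)
  qed
  \<comment> \<open>Since k^(ln(k+2)/ln k) = k + 2, the power of the vertex number is ((k+2)^2/k)^n;
    the cancellation uses ln k > 0.\<close>
  moreover have "real (k ^ n) powr (2 * ln (x + 2) / ln x - 1) = ((x + 2)\<^sup>2 / x) ^ n" for n
  proof -
    have "ln x > 0" using x by simp
    then have "n * ln x * (2 * ln (x + 2) / ln x - 1) = n * ln ((x + 2)\<^sup>2 / x)"
      using x by (simp add: ln_div ln_realpow field_simps)
    moreover have "real (k ^ n) powr (2 * ln (x + 2) / ln x - 1) =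
        exp (n * ln x * (2 * ln (x + 2) / ln x - 1))"
      using x by (simp add: powr_def ln_realpow x_def[symmetric] mult.commute)
    moreover have "exp (n * ln ((x + 2)\<^sup>2 / x)) = ((x + 2)\<^sup>2 / x) ^ n"
      using x by (simp add: exp_of_nat_mult)
    ultimately show ?thesis
      by (simp only:)
  qed
  ultimately show ?thesis
    using H2_sierpinski_asymp[OF assms] unfolding card x_def Let_def by simp
qed

end
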